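(* Let $S$ be a Polish space, $\mu\in P(S)$, $\delta>0$, and let $c:S\times S\to\mathbb{R}_+$ be a nonnegative lower semicontinuous function satisfying $c(x,y)=0$ if and only if $x=y$. Let $A$ be a nonempty closed subset of $S$. Suppose that $\lambda^*\in[0,\infty)$ attains the infimum in $$\inf_{\lambda\ge0}\left\{\lambda\delta+\int\big(1-\lambda c(x,A)\big)^+d\mu(x)\right\},$$ and that the quantities $$\underline{c}:=\int_{\{x:\,c(x,A)<1/\lambda^*\}}c(x,A)\,d\mu(x),\qquad \overline{c}:=\int_{\{x:\,c(x,A)\le1/\lambda^*\}}c(x,A)\,d\mu(x)$$ satisfy $\underline{c}=\overline{c}$. Then $$\sup\{P(A):P\in P(S),\ d_c(\mu,P)\le\delta\}=\mu\left\{x\in S:c(x,A)\le\frac1{\lambda^*}\right\}.$$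
   Context: $P(S)$ is the set of Borel probability measures on $S$. For $\mu_1,\mu_2\in P(S)$, $\Pi(\mu_1,\mu_2)$ is the set of Borel probability measures on $S\times S$ with marginals $\mu_1,\mu_2$, and $d_c(\mu_1,\mu_2):=\inf\{\int c\,d\pi:\pi\in\Pi(\mu_1,\mu_2)\}$. $c(x,A):=\inf\{c(x,y):y\in A\}$ (a universally measurable function of $x$; $\mu$ is understood as extended to its completion). $a^+=\max(a,0)$. When $\lambda^*=0$, $1/\lambda^*$ is read as $+\infty$. *)

theory Defs
  imports "HOL-Probability.Probability"
begin

definition lower_semicontinuous :: "('a::topological_space \<Rightarrow> real) \<Rightarrow> bool" where
  "lower_semicontinuous f \<longleftrightarrow>
     (\<forall>x a. a < f x \<longrightarrow> (\<forall>\<^sub>F y in nhds x. a < f y))"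

definition couplings ::
  "'a::topological_space measure \<Rightarrow> 'a measure \<Rightarrow> ('a \<times> 'a) measure set" where
  "couplings \<mu>1 \<mu>2 =
     {\<pi> \<in> space (prob_algebra borel). distr \<pi> borel fst = \<mu>1 \<and> distr \<pi> borel snd = \<mu>2}"

(* Values in [0, \<infinity>], since the transport cost may be infinite. *)
definition transport_cost ::
  "('a::topological_space \<times> 'a \<Rightarrow> real) \<Rightarrow> 'a measure \<Rightarrow> 'a measure \<Rightarrow> ennreal" where
  "transport_cost c \<mu>1 \<mu>2 = (INF \<pi>\<in>couplings \<mu>1 \<mu>2. \<integral>\<^sup>+z. ennreal (c z) \<partial>\<pi>)"

(* The infimum is the conditionally complete one on the reals: it is meaningful only
   for nonempty A and for c(x, -) bounded below on A. *)
definition cost_to_set :: "('a \<times> 'a \<Rightarrow> real) \<Rightarrow> 'a \<Rightarrow> 'a set \<Rightarrow> real" where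
  "cost_to_set c x A = (INF y\<in>A. c (x, y))"

(* cost_to_set c - A is in general only universally measurable, so integrals and
   measures of its level sets are taken with respect to the completion of \<mu>. *)
definition dual_objective ::
  "('a::topological_space \<times> 'a \<Rightarrow> real) \<Rightarrow> 'a measure \<Rightarrow> 'a set \<Rightarrow> real \<Rightarrow> real \<Rightarrow> real" where
  "dual_objective c \<mu> A \<delta> l =
     l * \<delta> + (\<integral>x. max (1 - l * cost_to_set c x A) 0 \<partial>completion \<mu>)"

(* Division in ennreal satisfies 1 / 0 = \<infinity>, so for l = 0 both regions below are the whole
   space. The two integrals are [0, \<infinity>]-valued. *)
definition lower_cost ::
  "('a::topological_space \<times> 'a \<Rightarrow> real) \<Rightarrow> 'a measure \<Rightarrow> 'a set \<Rightarrow> real \<Rightarrow> ennreal" where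
  "lower_cost c \<mu> A l =
     (\<integral>\<^sup>+x\<in>{x. ennreal (cost_to_set c x A) < 1 / ennreal l}.
        ennreal (cost_to_set c x A) \<partial>completion \<mu>)"

definition upper_cost ::
  "('a::topological_space \<times> 'a \<Rightarrow> real) \<Rightarrow> 'a measure \<Rightarrow> 'a set \<Rightarrow> real \<Rightarrow> ennreal" where
  "upper_cost c \<mu> A l =
     (\<integral>\<^sup>+x\<in>{x. ennreal (cost_to_set c x A) \<le> 1 / ennreal l}.
        ennreal (cost_to_set c x A) \<partial>completion \<mu>)"

end

theory Submission
  imports Defs
begin

text \<open>
  Write \<open>g x = c(x, A)\<close> and call a point cheap if \<open>l * g x \<le> 1\<close>. The supremum asks how much mass can
  be brought into \<open>A\<close> with transport budget \<open>\<delta>\<close>; the answer is a fractional knapsack: move the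
  points in order of increasing price \<open>g\<close> until the budget is exhausted, and \<open>1 / l\<close> is the price at
  which this happens.

  Upper bound. For \<open>l \<ge> 0\<close> one has
  \<open>1\<^sub>A(y) \<le> l * c(x, y) + max (1 - l * g x) 0\<close>, and integrating this against couplings of nearly minimal
  cost bounds \<open>P(A)\<close> by the dual objective at \<open>l\<close> (\<open>weak_duality\<close>). That the dual objective is minimal
  at \<open>l\<close> is exploited through its one-sided derivatives: the right derivative shows that moving the
  points with \<open>l * g x < 1\<close> costs at most \<open>\<delta>\<close>, the left derivative (for \<open>l > 0\<close>) that moving those
  with \<open>l * g x \<le> 1\<close> costs at least \<open>\<delta>\<close>. As the two costs agree by assumption, for \<open>l > 0\<close> the
  cheap points cost exactly \<open>\<delta>\<close>, and the dual objective at \<open>l\<close> collapses to the mass of the cheap points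
  (\<open>dual_minimum_eq_measure_of_cheap_points\<close>). For \<open>l = 0\<close> every point is cheap and the objective is 1.

  Lower bound. Let \<open>T x\<close> be a point of \<open>A\<close> with \<open>c (x, T x) \<le> g x + e\<close>, measurable in \<open>x\<close>. Moving
  the cheap points along \<open>T\<close> brings their whole mass into \<open>A\<close> at cost at most \<open>\<delta> + e\<close>. Mixing this
  plan with the identity plan, with weight \<open>\<delta> / (\<delta> + e)\<close> on the former, makes it affordable
  (\<open>feasible_law_charging_target\<close>), and letting \<open>e\<close> tend to 0 gives the claim. Removing some
  cheap points instead would not do, since \<open>\<mu>\<close> may have atoms.

  Both the measurability of \<open>g\<close> and the existence of \<open>T\<close> rest on two facts about a closed set \<open>B\<close> in
  a product of Polish spaces: its projection is measurable for the completion of every finite Borel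
  measure (\<open>projection_of_closed_in_completion\<close>), and \<open>B\<close> contains the graph of a
  completion-measurable function on that projection (\<open>measurable_selection_of_closed\<close>). They apply
  because the sublevel sets of a lower semicontinuous cost are closed.
\<close>

section \<open>Projections of closed sets\<close>

text \<open>
  All but finitely many terms of the sequence lie in \<open>V (Suc n)\<close>, which finitely many small balls
  cover, and finitely many further balls cover the other terms.
\<close>
lemma range_subset_compact_of_nested_finite_covers:
  fixes y :: "nat \<Rightarrow> 'b::complete_space" and V :: "nat \<Rightarrow> 'b set"
  assumes mem: "\<And>n. y n \<in> V n"
    and dec: "decseq V"
    and cov: "\<And>n. \<exists>F. finite F \<and> V (Suc n) \<subseteq> (\<Union>d\<in>F. cball d ((1/2)^n))"
  shows "compact (closure (range y))"
proof -
  have "\<exists>K. finite K \<and> closure (range y) \<subseteq> (\<Union>d\<in>K. ball d e)" if "0 < e" for e :: real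
  proof -
    obtain n where n: "(1/2)^n < e"
      using \<open>0 < e\<close> real_arch_pow_inv[of e "1/2"] by auto
    obtain F where F: "finite F" "V (Suc n) \<subseteq> (\<Union>d\<in>F. cball d ((1/2)^n))"
      using cov by blast
    define K where "K = F \<union> y ` {..n}"
    have "y i \<in> (\<Union>d\<in>K. cball d ((1/2)^n))" for i
    proof (cases "i \<le> n")
      case True
      then show ?thesis unfolding K_def by (intro UN_I[of "y i"]) auto
    next
      case False
      then have "V i \<subseteq> V (Suc n)"
        using dec by (auto simp: decseq_def)
      then show ?thesis
        using mem[of i] F(2) unfolding K_def by blast
    qed
    then have "range y \<subseteq> (\<Union>d\<in>K. cball d ((1/2)^n))"
      by blast
    moreover have "finite K"
      using F unfolding K_def by auto
    ultimately have "closure (range y) \<subseteq> (\<Union>d\<in>K. cball d ((1/2)^n))"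
      by (intro closure_minimal closed_UN) auto
    also have "\<dots> \<subseteq> (\<Union>d\<in>K. ball d e)"
      using n by (intro UN_mono order_refl) auto
    finally show ?thesis
      using \<open>finite K\<close> by blast
  qed
  then show ?thesis
    unfolding compact_eq_totally_bounded by (simp add: complete_eq_closed)
qed

lemma dense_sequence:
  obtains d :: "nat \<Rightarrow> 'b::{metric_space, second_countable_topology}"
  where "\<And>e y. e > 0 \<Longrightarrow> \<exists>i. y \<in> cball (d i) e"
proof -
  obtain D :: "'b set" where D: "countable D" "\<And>X. open X \<Longrightarrow> X \<noteq> {} \<Longrightarrow> \<exists>d \<in> D. d \<in> X"
    by (erule countable_dense_setE)
  have "D \<noteq> {}"
    using D(2)[of UNIV] by auto
  show thesis
  proof
    fix e :: real and y :: 'b assume "e > 0"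
    then obtain z where "z \<in> D" "z \<in> ball y e"
      using D(2)[of "ball y e"] by (metis centre_in_ball empty_iff open_ball)
    then show "\<exists>i. y \<in> cball (from_nat_into D i) e"
      using from_nat_into_surj[OF D(1)] by (metis dist_commute less_imp_le mem_ball mem_cball)
  qed
qed

text \<open>
  This is the capacitability argument, in the form it takes for closed sets. Cover the second factor
  by countably many balls of radius \<open>(1/2)^n\<close>. Because outer measure is continuous along increasing
  sequences of arbitrary sets, keeping only finitely many of these balls, for each \<open>n\<close> in turn,
  preserves an outer measure above \<open>a\<close>. The closures of the resulting projections are measurable and
  decrease to a set of measure at least \<open>a\<close>. Each point of that set is a limit of first components
  of points of \<open>B\<close> whose second components lie in a compact set, so a convergent subsequence and the
  closedness of \<open>B\<close> put it into the projection.
\<close>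
lemma closed_inner_approximation_of_projection:
  fixes M :: "'a::metric_space measure" and B :: "('a \<times> 'b::polish_space) set"
  assumes sets: "sets M = sets borel" and fin: "finite_measure M"
    and B: "closed B" and a: "a < outer_measure_of M (fst ` B)"
  shows "\<exists>K. closed K \<and> K \<subseteq> fst ` B \<and> a \<le> emeasure M K"
proof -
  interpret finite_measure M by fact
  obtain d :: "nat \<Rightarrow> 'b" where d: "\<And>e y. e > 0 \<Longrightarrow> \<exists>i. y \<in> cball (d i) e"
    using dense_sequence by metis
  have space: "space M = UNIV"
    using sets_eq_imp_space_eq[OF sets] by simp
  define om where "om V = outer_measure_of M (fst ` (B \<inter> UNIV \<times> V))" for V :: "'b set"
  have "\<exists>V. \<forall>n. (closed (V n) \<and> a < om (V n)) \<and>
      (V (Suc n) \<subseteq> V n \<and> (\<exists>F. finite F \<and> V (Suc n) \<subseteq> (\<Union>d\<in>F. cball d ((1/2)^n))))"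
  proof (rule dependent_nat_choice)
    show "\<exists>V. closed V \<and> a < om V"
      using a unfolding om_def by (intro exI[of _ UNIV]) auto
  next
    fix V n assume V: "closed V \<and> a < om V"
    define W where "W k = V \<inter> (\<Union>i\<le>k. cball (d i) ((1/2)^n))" for k :: nat
    have "(\<Union>k. W k) = V"
      using d[of "(1/2)^n"] unfolding W_def by fastforce
    then have "(\<Union>k. fst ` (B \<inter> UNIV \<times> W k)) = fst ` (B \<inter> UNIV \<times> V)"
      by (force simp: image_iff)
    moreover have "incseq (\<lambda>k. fst ` (B \<inter> UNIV \<times> W k))"
      unfolding W_def by (intro monoI image_mono) fastforce
    ultimately have "(SUP k. om (W k)) = om V"
      unfolding om_def using SUP_outer_measure_of_incseq[of "\<lambda>k. fst ` (B \<inter> UNIV \<times> W k)" M]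
      by (simp add: space)
    then obtain k where "a < om (W k)"
      using V by (metis less_SUP_iff)
    moreover have "closed (W k)"
      using V unfolding W_def by (intro closed_Int closed_UN) auto
    moreover have "W k \<subseteq> (\<Union>x\<in>d ` {..k}. cball x ((1/2)^n))"
      unfolding W_def by auto
    ultimately show "\<exists>V'. (closed V' \<and> a < om V') \<and>
        (V' \<subseteq> V \<and> (\<exists>F. finite F \<and> V' \<subseteq> (\<Union>d\<in>F. cball d ((1/2)^n))))"
      by (intro exI[of _ "W k"]) (auto simp: W_def intro!: exI[of _ "d ` {..k}"])
  qed
  then obtain V where closed: "\<And>n. closed (V n)" and big: "\<And>n. a < om (V n)"
    and Suc: "\<And>n. V (Suc n) \<subseteq> V n"
    and cov: "\<And>n. \<exists>F. finite F \<and> V (Suc n) \<subseteq> (\<Union>d\<in>F. cball d ((1/2)^n))"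
    by metis
  have dec: "decseq V"
    using Suc by (rule decseq_SucI)
  \<comment> \<open>The projections need not be Borel; their closures are, and measure is continuous along them.\<close>
  define C where "C n = closure (fst ` (B \<inter> UNIV \<times> V n))" for n
  have C: "C n \<in> sets M" for n
    unfolding C_def sets by simp
  have "decseq C"
    unfolding C_def using Suc
    by (intro decseq_SucI closure_mono image_mono) blast
  have "a \<le> emeasure M (C n)" for n
  proof -
    have "om (V n) \<le> outer_measure_of M (C n)"
      unfolding om_def C_def by (intro outer_measure_of_mono closure_subset)
    then show ?thesis
      using big[of n] C[of n] by simp
  qed
  then have "a \<le> (INF n. emeasure M (C n))"
    by (intro INF_greatest)
  also have "\<dots> = emeasure M (\<Inter>n. C n)"
    using C \<open>decseq C\<close> by (intro INF_emeasure_decseq) (auto simp: emeasure_eq_measure)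
  finally have "a \<le> emeasure M (\<Inter>n. C n)" .
  moreover have "(\<Inter>n. C n) \<subseteq> fst ` B"
  proof
    fix x assume x: "x \<in> (\<Inter>n. C n)"
    have "\<exists>z. z \<in> B \<and> snd z \<in> V n \<and> dist (fst z) x < (1/2)^n" for n
    proof -
      have "x \<in> closure (fst ` (B \<inter> UNIV \<times> V n))"
        using x unfolding C_def by auto
      then obtain u where "u \<in> fst ` (B \<inter> UNIV \<times> V n)" "dist u x < (1/2)^n"
        unfolding closure_approachable by (metis half_gt_zero_iff zero_less_one zero_less_power)
      then show ?thesis by force
    qed
    then obtain z where z: "\<And>n. z n \<in> B" "\<And>n. snd (z n) \<in> V n"
        "\<And>n. dist (fst (z n)) x < (1/2)^n"
      by metis
    have "compact (closure (range (\<lambda>n. snd (z n))))"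
      using z(2) dec cov by (rule range_subset_compact_of_nested_finite_covers)
    then have "seq_compact (closure (range (\<lambda>n. snd (z n))))"
      using compact_imp_seq_compact by blast
    moreover have "\<forall>n. snd (z n) \<in> closure (range (\<lambda>n. snd (z n)))"
      using closure_subset[of "range (\<lambda>n. snd (z n))"] by auto
    ultimately obtain y r where r: "strict_mono r" "((\<lambda>n. snd (z n)) \<circ> r) \<longlonglongrightarrow> y"
      by (rule seq_compactE)
    have pow: "(\<lambda>n. (1/2::real)^n) \<longlonglongrightarrow> 0"
      by (rule LIMSEQ_power_zero) simp
    have "(\<lambda>n. dist (fst (z n)) x) \<longlonglongrightarrow> 0"
      by (rule tendsto_sandwich[OF _ _ tendsto_const pow])
         (auto intro!: eventuallyI less_imp_le z(3))
    then have "(\<lambda>n. fst (z n)) \<longlonglongrightarrow> x"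
      by (rule tendsto_dist_iff[THEN iffD2])
    then have "((\<lambda>n. fst (z n)) \<circ> r) \<longlonglongrightarrow> x"
      using r(1) by (rule LIMSEQ_subseq_LIMSEQ)
    with r(2) have "(\<lambda>n. z (r n)) \<longlonglongrightarrow> (x, y)"
      using tendsto_Pair[of "\<lambda>n. fst (z (r n))" x sequentially "\<lambda>n. snd (z (r n))" y]
      by (simp add: comp_def)
    then have "(x, y) \<in> B"
      using B z(1) by (metis closed_sequentially)
    then show "x \<in> fst ` B" by force
  qed
  moreover have "closed (\<Inter>n. C n)"
    unfolding C_def by auto
  ultimately show ?thesis by blast
qed

text \<open>
  The projection lies between a countable union of closed sets and a measurable hull of the same
  finite measure, so it differs from a Borel set by a null set.
\<close>
lemma projection_of_closed_in_completion:
  fixes M :: "'a::metric_space measure" and B :: "('a \<times> 'b::polish_space) set"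
  assumes sets: "sets M = sets borel" and fin: "finite_measure M" and B: "closed B"
  shows "fst ` B \<in> sets (completion M)"
proof -
  interpret finite_measure M by fact
  have space: "space M = UNIV"
    using sets_eq_imp_space_eq[OF sets] by simp
  let ?P = "fst ` B" and ?K = "{K. closed K \<and> K \<subseteq> fst ` B}"
  have Kne: "?K \<noteq> {}" by blast
  have "outer_measure_of M ?P \<le> (SUP K\<in>?K. emeasure M K)"
  proof (rule dense_le)
    fix a assume "a < outer_measure_of M ?P"
    then obtain K where "K \<in> ?K" "a \<le> emeasure M K"
      using closed_inner_approximation_of_projection[OF sets fin B] by auto
    then show "a \<le> (SUP K\<in>?K. emeasure M K)"
      by (rule SUP_upper2)
  qed
  moreover obtain m :: "nat \<Rightarrow> ennreal" where m: "range m \<subseteq> emeasure M ` ?K"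
      "(SUP K\<in>?K. emeasure M K) = (SUP n. m n)"
    using ennreal_SUP_countable_SUP[OF Kne, of "emeasure M"] by auto
  obtain K where K: "\<And>n. K n \<in> ?K" "\<And>n. m n = emeasure M (K n)"
  proof -
    have "\<forall>n. \<exists>K. K \<in> ?K \<and> m n = emeasure M K"
      using m(1) by blast
    then show thesis
      using that by metis
  qed
  define U where "U = (\<Union>n. K n)"
  have K_sets: "K n \<in> sets M" for n
    using K(1)[of n] unfolding sets by auto
  have U: "U \<in> sets M" "U \<subseteq> ?P"
    using K_sets K(1) unfolding U_def by auto
  have "(SUP n. m n) \<le> emeasure M U"
    unfolding K(2) using K_sets by (intro SUP_least emeasure_mono) (auto simp: U_def)
  moreover obtain E where E: "E \<in> sets M" "?P \<subseteq> E" "outer_measure_of M ?P = emeasure M E"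
    using outer_measure_of_attain[of ?P M] space by auto
  ultimately have "emeasure M E \<le> emeasure M U"
    using m(2) by simp
  then have "emeasure M (E - U) = 0"
    using U E emeasure_Diff[of M U E]
    by (simp add: diff_eq_0_ennreal less_top[symmetric] order_trans[OF U(2) E(2)])
  then have "E - U \<in> null_sets M"
    using E U by auto
  then have "?P - U \<in> null_sets (completion M)"
    using E(2) by (intro null_sets_completion_subset[OF Diff_mono[OF E(2) order_refl]] null_sets_completionI)
  then have "U \<union> (?P - U) \<in> sets (completion M)"
    using U by (intro sets.Un) auto
  moreover have "U \<union> (?P - U) = ?P"
    using U by blast
  ultimately show ?thesis by simp
qed

section \<open>Measurable selection from a closed relation\<close>

text \<open>
  For \<open>x\<close> in the projection, pick greedily a ball of radius \<open>1\<close>, then one of radius \<open>1/2\<close>, and so on,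
  each time with the least index for which the section of \<open>B\<close> above \<open>x\<close> still meets the intersection
  of all balls chosen so far. The centres converge to a point of the section, which is closed. The
  list of the indices chosen depends measurably on \<open>x\<close> because each query is membership in the
  projection of a closed set.
\<close>
lemma measurable_selection_of_closed:
  fixes M :: "'a::metric_space measure" and B :: "('a \<times> 'b::polish_space) set"
  assumes sets: "sets M = sets borel" and fin: "finite_measure M" and B: "closed B"
  obtains f where "f \<in> completion M \<rightarrow>\<^sub>M borel" "\<And>x. x \<in> fst ` B \<Longrightarrow> (x, f x) \<in> B"
proof -
  have space: "space M = UNIV"
    using sets_eq_imp_space_eq[OF sets] by simp
  obtain d :: "nat \<Rightarrow> 'b" where d: "\<And>e y. e > 0 \<Longrightarrow> \<exists>i. y \<in> cball (d i) e"
    using dense_sequence by metis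
  define W where "W s = (\<Inter>n<length s. cball (d (s ! n)) ((1/2)^n))" for s
  define Q where "Q s x \<longleftrightarrow> x \<in> fst ` (B \<inter> UNIV \<times> W s)" for s x
  define L where "L n x = rec_nat [] (\<lambda>n s. s @ [LEAST i. Q (s @ [i]) x]) n" for n and x :: 'a
  have L_0: "L 0 x = []" and L_Suc: "L (Suc n) x = L n x @ [LEAST i. Q (L n x @ [i]) x]" for n x
    unfolding L_def by auto
  have len: "length (L n x) = n" for n x
    by (induction n) (auto simp: L_0 L_Suc)
  have W_snoc: "W (s @ [i]) = W s \<inter> cball (d i) ((1/2)^length s)" for s i
  proof -
    have "(\<Inter>n<length s. cball (d ((s @ [i]) ! n)) ((1/2)^n)) = W s"
      unfolding W_def by (intro INF_cong) (auto simp: nth_append)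
    then show ?thesis
      unfolding W_def by (simp add: lessThan_Suc Int_commute)
  qed
  have meas_Q: "Measurable.pred (completion M) (Q s)" for s
  proof -
    have "closed (B \<inter> UNIV \<times> W s)"
      using B unfolding W_def by (intro closed_Int closed_Times closed_INT) auto
    then have "fst ` (B \<inter> UNIV \<times> W s) \<in> sets (completion M)"
      by (rule projection_of_closed_in_completion[OF sets fin])
    then show ?thesis
      unfolding Q_def pred_def by (simp add: space)
  qed
  have meas_L: "L n \<in> completion M \<rightarrow>\<^sub>M count_space UNIV" for n
  proof (induction n)
    case 0
    then show ?case by (simp add: L_0[abs_def])
  next
    case (Suc n)
    have "(\<lambda>x. s @ [LEAST i. Q (s @ [i]) x]) \<in> completion M \<rightarrow>\<^sub>M count_space UNIV" for s
      using measurable_compose[OF measurable_Least[OF meas_Q], of "\<lambda>i. s @ [i]" "count_space UNIV" "\<lambda>i. s @ [i]"]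
      by simp
    from measurable_compose_countable[OF this Suc] show ?case
      by (simp add: L_Suc[abs_def])
  qed
  have Q_L: "Q (L n x) x" if "x \<in> fst ` B" for n x
  proof (induction n)
    case 0
    then show ?case using that by (simp add: L_0 Q_def W_def)
  next
    case (Suc n)
    then obtain y where y: "(x, y) \<in> B" "y \<in> W (L n x)"
      unfolding Q_def by auto
    obtain i where "y \<in> cball (d i) ((1/2)^n)"
      using d[of "(1/2)^n"] by auto
    then have "Q (L n x @ [i]) x"
      using y unfolding Q_def W_snoc len by force
    then show ?case
      unfolding L_Suc by (rule LeastI)
  qed
  \<comment> \<open>The constant value off the projection makes the sequence converge everywhere.\<close>
  define g where "g n x = (if x \<in> fst ` B then d (last (L (Suc n) x)) else d 0)" for n x
  have [measurable]: "g n \<in> completion M \<rightarrow>\<^sub>M borel" for n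
  proof -
    have "{x \<in> space (completion M). x \<in> fst ` B} \<in> sets (completion M)"
      using projection_of_closed_in_completion[OF assms] by (simp add: space)
    moreover have "(\<lambda>x. d (last (L (Suc n) x))) \<in> completion M \<rightarrow>\<^sub>M borel"
      by (rule measurable_compose[OF meas_L]) simp
    ultimately show ?thesis
      unfolding g_def by (intro measurable_If) auto
  qed
  have lim: "\<exists>y. (\<lambda>n. g n x) \<longlonglongrightarrow> y \<and> (x \<in> fst ` B \<longrightarrow> (x, y) \<in> B)" for x
  proof (cases "x \<in> fst ` B")
    case False
    then show ?thesis unfolding g_def by auto
  next
    case True
    then have "\<exists>y. (x, y) \<in> B \<and> y \<in> W (L (Suc n) x)" for n
      using Q_L[of x "Suc n"] unfolding Q_def by auto
    then obtain y where y: "\<And>n. (x, y n) \<in> B" "\<And>n. y n \<in> W (L (Suc n) x)"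
      by metis
    have W_mono: "W (L (m + n) x) \<subseteq> W (L m x)" for m n
      by (induction n) (auto simp: L_Suc W_snoc)
    have near: "dist (g n x) (y m) \<le> (1/2)^n" if "n \<le> m" for n m
    proof -
      have "y m \<in> W (L (Suc n) x)"
        using y(2)[of m] W_mono[of "Suc n" "m - n"] that by auto
      then show ?thesis
        using True by (simp add: L_Suc W_snoc len g_def)
    qed
    have pow: "(\<lambda>n. (1/2::real)^n) \<longlonglongrightarrow> 0"
      by (rule LIMSEQ_power_zero) simp
    have "Cauchy y"
    proof (rule metric_CauchyI)
      fix e :: real assume "e > 0"
      then obtain N where N: "(1/2)^N < e / 2"
        using real_arch_pow_inv[of "e/2" "1/2"] by auto
      have "dist (y m) (y n) < e" if "m \<ge> N" "n \<ge> N" for m n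
        using dist_triangle3[of "y m" "y n" "g N x"] near[OF that(1)] near[OF that(2)] N by linarith
      then show "\<exists>N. \<forall>m\<ge>N. \<forall>n\<ge>N. dist (y m) (y n) < e" by blast
    qed
    then obtain z where z: "y \<longlonglongrightarrow> z"
      using Cauchy_convergent convergent_def by blast
    have "(\<lambda>n. dist (g n x) (y n)) \<longlonglongrightarrow> 0"
      by (rule tendsto_sandwich[OF _ _ tendsto_const pow]) (auto intro!: eventuallyI near)
    moreover have "(\<lambda>n. dist (y n) z) \<longlonglongrightarrow> 0"
      using z by (simp add: tendsto_dist_iff[symmetric])
    ultimately have sum: "(\<lambda>n. dist (g n x) (y n) + dist (y n) z) \<longlonglongrightarrow> 0"
      by (rule tendsto_add_zero)
    have "(\<lambda>n. dist (g n x) z) \<longlonglongrightarrow> 0"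
      by (rule tendsto_sandwich[OF _ _ tendsto_const sum])
         (auto intro!: eventuallyI dist_triangle)
    then have "(\<lambda>n. g n x) \<longlonglongrightarrow> z"
      by (simp add: tendsto_dist_iff[symmetric])
    moreover have "(x, z) \<in> B"
      by (rule closed_sequentially[OF B _ tendsto_Pair[OF tendsto_const z]]) (rule y(1))
    ultimately show ?thesis by blast
  qed
  then obtain f where f: "\<And>x. (\<lambda>n. g n x) \<longlonglongrightarrow> f x" "\<And>x. x \<in> fst ` B \<Longrightarrow> (x, f x) \<in> B"
    by metis
  have "f \<in> completion M \<rightarrow>\<^sub>M borel"
    by (rule borel_measurable_LIMSEQ_metric[where f=g]) (auto intro: f(1))
  then show thesis using f(2) that by blast
qed

section \<open>The cost of reaching a closed set\<close>

lemma closed_sublevel_of_lower_semicontinuous: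
  assumes "lower_semicontinuous f"
  shows "closed {x. f x \<le> a}"
proof -
  have "open {x. a < f x}"
  proof (subst open_subopen, intro ballI)
    fix x assume "x \<in> {x. a < f x}"
    then obtain U where "open U" "x \<in> U" "\<forall>y\<in>U. a < f y"
      using assms unfolding lower_semicontinuous_def eventually_nhds by blast
    then show "\<exists>U. open U \<and> x \<in> U \<and> U \<subseteq> {x. a < f x}"
      by blast
  qed
  moreover have "{x. a < f x} = - {x. f x \<le> a}" by auto
  ultimately show ?thesis
    by (simp add: closed_def)
qed

lemma borel_measurable_lower_semicontinuous:
  assumes "lower_semicontinuous f"
  shows "f \<in> borel_measurable borel"
  unfolding borel_measurable_iff_le
  using closed_sublevel_of_lower_semicontinuous[OF assms] by simp

lemma cost_to_set_less_iff:
  assumes "\<And>z. 0 \<le> c z" "A \<noteq> {}"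
  shows "cost_to_set c x A < r \<longleftrightarrow> (\<exists>y\<in>A. c (x, y) < r)"
  unfolding cost_to_set_def using assms by (intro cINF_less_iff bdd_belowI2[of _ 0]) auto

lemma cost_to_set_nonneg:
  assumes "\<And>z. 0 \<le> c z" "A \<noteq> {}"
  shows "0 \<le> cost_to_set c x A"
  unfolding cost_to_set_def using assms by (intro cINF_greatest) auto

lemma cost_to_set_le:
  assumes "\<And>z. 0 \<le> c z" "y \<in> A"
  shows "cost_to_set c x A \<le> c (x, y)"
  unfolding cost_to_set_def using assms by (intro cINF_lower bdd_belowI2[of _ 0]) auto

text \<open>
  Pairs that lead into \<open>A\<close> at cost at most \<open>r\<close>: these are the closed relations to which the projection
  and selection results are applied.
\<close>
lemma closed_affordable_moves:
  assumes "lower_semicontinuous c" "closed A"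
  shows "closed {z. snd z \<in> A \<and> c z \<le> r}"
proof -
  have "{z. snd z \<in> A \<and> c z \<le> r} = (UNIV \<times> A) \<inter> {z. c z \<le> r}"
    by auto
  then show ?thesis
    by (metis closed_Int closed_Times closed_UNIV assms(2)
        closed_sublevel_of_lower_semicontinuous[OF assms(1)])
qed

text \<open>
  The infimum need not be attained, so \<open>{x. c(x, A) < r}\<close> is written as a countable union of projections
  of closed relations with bounds strictly below \<open>r\<close>.
\<close>
lemma borel_measurable_cost_to_set:
  fixes M :: "'a::polish_space measure"
  assumes M: "sets M = sets borel" "finite_measure M"
    and c: "\<And>z. 0 \<le> c z" "lower_semicontinuous c" and A: "closed A" "A \<noteq> {}"
  shows "(\<lambda>x. cost_to_set c x A) \<in> borel_measurable (completion M)"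
  unfolding borel_measurable_iff_less
proof
  fix r :: real
  define B where "B n = {z. snd z \<in> A \<and> c z \<le> r - 1 / real (Suc n)}" for n
  have "cost_to_set c x A < r \<longleftrightarrow> (\<exists>n. x \<in> fst ` B n)" for x
  proof
    assume "cost_to_set c x A < r"
    then obtain y where "y \<in> A" "c (x, y) < r"
      unfolding cost_to_set_less_iff[of c, OF c(1) A(2)] by blast
    moreover obtain n where "1 / real (Suc n) < r - c (x, y)"
      using \<open>c (x, y) < r\<close> nat_approx_posE[of "r - c (x, y)"] by auto
    ultimately have "(x, y) \<in> B n"
      unfolding B_def by auto
    then show "\<exists>n. x \<in> fst ` B n"
      by (intro exI[of _ n] image_eqI[of x fst "(x, y)"]) simp_all
  next
    assume "\<exists>n. x \<in> fst ` B n"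
    then obtain n y where "y \<in> A" "c (x, y) \<le> r - 1 / real (Suc n)"
      unfolding B_def by auto
    moreover have "1 / real (Suc n) > 0" by simp
    ultimately show "cost_to_set c x A < r"
      unfolding cost_to_set_less_iff[of c, OF c(1) A(2)] by (intro bexI[of _ y]) linarith+
  qed
  moreover have "space M = UNIV"
    using sets_eq_imp_space_eq[OF M(1)] by simp
  ultimately have "{w \<in> space (completion M). cost_to_set c w A < r} = (\<Union>n. fst ` B n)"
    by (intro set_eqI) (simp only: mem_Collect_eq space_completion UN_iff, simp)
  also have "\<dots> \<in> sets (completion M)"
  proof (rule sets.countable_UN, rule image_subsetI)
    show "fst ` B n \<in> sets (completion M)" for n
      unfolding B_def
      by (rule projection_of_closed_in_completion[OF M closed_affordable_moves[OF c(2) A(1)]])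
  qed
  finally show "{w \<in> space (completion M). cost_to_set c w A < r} \<in> sets (completion M)" .
qed

text \<open>
  Exact minimisers may not exist. Points whose price lies in \<open>[k e, (k + 1) e)\<close> can all be moved at
  cost at most \<open>(k + 1) e\<close>, so one selection for each \<open>k\<close>, glued along the levels of the price, loses
  at most \<open>e\<close>.
\<close>
lemma nearly_optimal_measurable_move:
  fixes M :: "'a::polish_space measure"
  assumes M: "sets M = sets borel" "finite_measure M"
    and c: "\<And>z. 0 \<le> c z" "lower_semicontinuous c" and A: "closed A" "A \<noteq> {}"
    and e: "e > 0"
  obtains T where "T \<in> completion M \<rightarrow>\<^sub>M borel"
    "\<And>x. T x \<in> A" "\<And>x. c (x, T x) \<le> cost_to_set c x A + e"
proof -
  define B where "B k = {z. snd z \<in> A \<and> c z \<le> (real k + 1) * e}" for k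
  have "\<exists>f. f \<in> completion M \<rightarrow>\<^sub>M borel \<and> (\<forall>x \<in> fst ` B k. (x, f x) \<in> B k)" for k
  proof -
    have "closed (B k)"
      unfolding B_def by (rule closed_affordable_moves[OF c(2) A(1)])
    then obtain f where "f \<in> completion M \<rightarrow>\<^sub>M borel" "\<And>x. x \<in> fst ` B k \<Longrightarrow> (x, f x) \<in> B k"
      using measurable_selection_of_closed[OF M] by metis
    then show ?thesis
      by (intro exI[of _ f] conjI ballI)
  qed
  then obtain f where f: "\<And>k. f k \<in> completion M \<rightarrow>\<^sub>M borel"
    "\<And>k x. x \<in> fst ` B k \<Longrightarrow> (x, f k x) \<in> B k"
    by metis
  have [measurable]: "(\<lambda>x. cost_to_set c x A) \<in> borel_measurable (completion M)"
    by (rule borel_measurable_cost_to_set[where c=c, OF M c A])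
  define k where "k x = nat \<lfloor>cost_to_set c x A / e\<rfloor>" for x
  have k_meas: "k \<in> completion M \<rightarrow>\<^sub>M count_space UNIV"
    unfolding k_def by measurable
  have k: "real (k x) * e \<le> cost_to_set c x A" "cost_to_set c x A < (real (k x) + 1) * e" for x
  proof -
    have "0 \<le> \<lfloor>cost_to_set c x A / e\<rfloor>"
      using cost_to_set_nonneg[of c, OF c(1) A(2)] e by simp
    then have eq: "real (k x) = of_int \<lfloor>cost_to_set c x A / e\<rfloor>"
      unfolding k_def by simp
    show "real (k x) * e \<le> cost_to_set c x A" "cost_to_set c x A < (real (k x) + 1) * e"
      unfolding eq pos_le_divide_eq[OF e, symmetric] pos_divide_less_eq[OF e, symmetric]
      by (rule of_int_floor_le) (rule real_of_int_floor_add_one_gt)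
  qed
  have T: "(x, f (k x) x) \<in> B (k x)" for x
  proof -
    obtain y where "y \<in> A" "c (x, y) < (real (k x) + 1) * e"
      using k(2)[of x] unfolding cost_to_set_less_iff[of c, OF c(1) A(2)] by blast
    then have "(x, y) \<in> B (k x)"
      unfolding B_def by auto
    then show ?thesis
      by (intro f(2) image_eqI[of x fst "(x, y)"]) simp_all
  qed
  show thesis
  proof
    show "(\<lambda>x. f (k x) x) \<in> completion M \<rightarrow>\<^sub>M borel"
      by (rule measurable_compose_countable[OF f(1) k_meas])
    show "f (k x) x \<in> A" for x
      using T[of x] unfolding B_def by simp
    show "c (x, f (k x) x) \<le> cost_to_set c x A + e" for x
      using T[of x] k(1)[of x] unfolding B_def by (simp add: algebra_simps)
  qed
qed

section \<open>Weak duality\<close>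

lemma borel_measurable_fst_snd_borel:
  "fst \<in> (borel :: ('a::topological_space \<times> 'b::topological_space) measure) \<rightarrow>\<^sub>M borel"
  "snd \<in> (borel :: ('a::topological_space \<times> 'b::topological_space) measure) \<rightarrow>\<^sub>M borel"
  by (auto intro!: borel_measurable_continuous_onI continuous_intros)

text \<open>
  If \<open>y\<close> is in \<open>A\<close> then \<open>l * c(x, A) \<le> l * c(x, y)\<close>, whence
  \<open>1 \<le> l * c(x, y) + max (1 - l * c(x, A)) 0\<close>. Integrate over a coupling of cost below \<open>\<delta> + e\<close>
  and let \<open>e\<close> tend to 0.
\<close>
lemma weak_duality:
  fixes M :: "'a::polish_space measure"
  assumes M: "M \<in> space (prob_algebra borel)"
    and c: "\<And>z. 0 \<le> c z" "lower_semicontinuous c" and A: "closed A" "A \<noteq> {}"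
    and P: "P \<in> space (prob_algebra borel)" and le: "transport_cost c M P \<le> ennreal \<delta>"
    and "0 \<le> \<delta>" "0 \<le> l"
  shows "measure P A \<le> dual_objective c M A \<delta> l"
proof -
  have M': "sets M = sets borel" and "prob_space M"
    using M by (auto simp: space_prob_algebra)
  interpret M: prob_space M by (rule \<open>prob_space M\<close>)
  interpret C: prob_space "completion M" by (rule M.prob_space_completion)
  interpret P: prob_space P using P by (simp add: space_prob_algebra)
  define h where "h x = max (1 - l * cost_to_set c x A) 0" for x
  have g_meas [measurable]: "(\<lambda>x. cost_to_set c x A) \<in> borel_measurable (completion M)"
    by (rule borel_measurable_cost_to_set[where c=c, OF M' M.finite_measure_axioms c A])
  have h: "0 \<le> h x" "h x \<le> 1" for x
    using cost_to_set_nonneg[of c, OF c(1) A(2)] \<open>0 \<le> l\<close> unfolding h_def by auto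
  have h_meas [measurable]: "h \<in> borel_measurable (completion M)"
    unfolding h_def by measurable
  have h_int: "integrable (completion M) h"
    using h by (intro C.integrable_const_bound[of _ 1]) auto
  \<comment> \<open>A Borel version of \<open>h\<close>, so that \<open>h (fst z)\<close> can be integrated against Borel couplings.\<close>
  obtain h' where h': "h' \<in> borel_measurable M" "AE x in M. ennreal (h x) = h' x"
    using completion_ex_borel_measurable[of "\<lambda>x. ennreal (h x)" M] by auto
  have h'_eq: "(\<integral>\<^sup>+x. h' x \<partial>M) = ennreal (\<integral>x. h x \<partial>completion M)"
  proof -
    have "(\<integral>\<^sup>+x. h' x \<partial>M) = (\<integral>\<^sup>+x. ennreal (h x) \<partial>M)"
      using h'(2) by (intro nn_integral_cong_AE) auto
    also have "\<dots> = (\<integral>\<^sup>+x. ennreal (h x) \<partial>completion M)"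
      by (simp add: nn_integral_completion)
    also have "\<dots> = ennreal (\<integral>x. h x \<partial>completion M)"
      using h by (intro nn_integral_eq_integral h_int) auto
    finally show ?thesis .
  qed
  have h'_borel: "h' \<in> borel_measurable borel"
    using h'(1) measurable_cong_sets[OF M' refl] by blast
  have bound: "measure P A \<le> l * (\<delta> + e) + (\<integral>x. h x \<partial>completion M)" if "e > 0" for e
  proof -
    have "transport_cost c M P < ennreal (\<delta> + e)"
      using le \<open>e > 0\<close> \<open>0 \<le> \<delta>\<close> by (simp add: le_less_trans ennreal_less_iff)
    then obtain \<pi> where \<pi>: "\<pi> \<in> couplings M P" "(\<integral>\<^sup>+z. ennreal (c z) \<partial>\<pi>) < ennreal (\<delta> + e)"
      unfolding transport_cost_def INF_less_iff by auto
    then have sets_\<pi>: "sets \<pi> = sets borel" and fst_\<pi>: "distr \<pi> borel fst = M"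
      and snd_\<pi>: "distr \<pi> borel snd = P"
      unfolding couplings_def by (auto simp: space_prob_algebra)
    have [measurable]: "fst \<in> \<pi> \<rightarrow>\<^sub>M borel" "snd \<in> \<pi> \<rightarrow>\<^sub>M borel" "c \<in> borel_measurable \<pi>"
      using borel_measurable_fst_snd_borel borel_measurable_lower_semicontinuous[OF c(2)]
      unfolding measurable_cong_sets[OF sets_\<pi> refl] by auto
    note h'_borel [measurable]
    have "AE z in \<pi>. ennreal (h (fst z)) = h' (fst z)"
      by (rule AE_distrD[where M'=borel]) (use h'(2) fst_\<pi> in auto)
    moreover have "indicator A (snd z) \<le> ennreal l * ennreal (c z) + ennreal (h (fst z))" for z
    proof (cases "snd z \<in> A")
      case True
      then have "l * cost_to_set c (fst z) A \<le> l * c z"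
        using cost_to_set_le[of c, OF c(1), where y="snd z" and A=A and x="fst z"] \<open>0 \<le> l\<close> by (intro mult_left_mono) auto
      then have "1 \<le> l * c z + h (fst z)"
        unfolding h_def by linarith
      then have "ennreal 1 \<le> ennreal (l * c z + h (fst z))"
        by (rule ennreal_leI)
      then show ?thesis
        using True c(1) h(1) \<open>0 \<le> l\<close> by (simp add: ennreal_plus ennreal_mult)
    qed simp
    ultimately have "AE z in \<pi>. indicator A (snd z) \<le> ennreal l * ennreal (c z) + h' (fst z)"
      by (metis (mono_tags, lifting) eventually_mono)
    then have "(\<integral>\<^sup>+z. indicator A (snd z) \<partial>\<pi>) \<le> (\<integral>\<^sup>+z. ennreal l * ennreal (c z) + h' (fst z) \<partial>\<pi>)"
      by (rule nn_integral_mono_AE)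
    also have "\<dots> = ennreal l * (\<integral>\<^sup>+z. ennreal (c z) \<partial>\<pi>) + (\<integral>\<^sup>+z. h' (fst z) \<partial>\<pi>)"
      by (subst nn_integral_add) (auto simp: nn_integral_cmult)
    also have "(\<integral>\<^sup>+z. h' (fst z) \<partial>\<pi>) = (\<integral>\<^sup>+x. h' x \<partial>M)"
      unfolding fst_\<pi>[symmetric] by (subst nn_integral_distr) auto
    also have "ennreal l * (\<integral>\<^sup>+z. ennreal (c z) \<partial>\<pi>) + \<dots> \<le> ennreal l * ennreal (\<delta> + e) + \<dots>"
      using \<pi>(2) by (intro add_mono mult_left_mono) auto
    also have "\<dots> = ennreal (l * (\<delta> + e) + (\<integral>x. h x \<partial>completion M))"
      unfolding h'_eq using h(1) \<open>0 \<le> l\<close> \<open>0 \<le> \<delta>\<close> \<open>e > 0\<close> by (simp add: ennreal_plus ennreal_mult)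
    also have "(\<integral>\<^sup>+z. indicator A (snd z) \<partial>\<pi>) = (\<integral>\<^sup>+y. indicator A y \<partial>P)"
      unfolding snd_\<pi>[symmetric] using A(1) by (subst nn_integral_distr) auto
    also have "\<dots> = ennreal (measure P A)"
      using A(1) P by (subst nn_integral_indicator) (auto simp: space_prob_algebra P.emeasure_eq_measure)
    finally show ?thesis
      using h(1) \<open>0 \<le> l\<close> \<open>0 \<le> \<delta>\<close> \<open>e > 0\<close> by (subst (asm) ennreal_le_iff) auto
  qed
  show ?thesis
  proof (rule field_le_epsilon)
    fix e :: real assume "e > 0"
    define e' where "e' = e / (l + 1)"
    have e': "e' > 0" "l * e' \<le> e"
      using \<open>e > 0\<close> \<open>0 \<le> l\<close> unfolding e'_def by (auto simp: field_simps)
    show "measure P A \<le> dual_objective c M A \<delta> l + e"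
      using bound[OF e'(1)] e'(2) unfolding dual_objective_def h_def by (simp add: algebra_simps)
  qed
qed

section \<open>Optimality conditions for the dual problem\<close>

text \<open>
  The right derivative of the dual objective at a minimiser is nonnegative. Where
  \<open>(l + s) * g x \<le> 1\<close>, raising the multiplier from \<open>l\<close> to \<open>l + s\<close> lowers the integrand by exactly
  \<open>s * g x\<close>, so these points cost at most \<open>\<delta>\<close>; as \<open>s\<close> decreases to 0 they exhaust
  \<open>{x. l * g x < 1}\<close>. When \<open>l = 0\<close> the integrability of \<open>g\<close> is part of
  what is shown, so the integral is taken in \<open>[0, \<infinity>]\<close> and the limit is monotone.
\<close>
lemma (in prob_space) strictly_cheap_cost_le_budget_if_minimizer:
  fixes g :: "'a \<Rightarrow> real" and l \<delta> :: real
  defines "h \<equiv> \<lambda>t x. max (1 - t * g x) 0"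
  assumes g [measurable]: "g \<in> borel_measurable M" and g_nonneg: "\<And>x. 0 \<le> g x"
    and "0 \<le> l" "0 \<le> \<delta>"
    and min: "\<And>t. 0 \<le> t \<Longrightarrow> l * \<delta> + expectation (h l) \<le> t * \<delta> + expectation (h t)"
  shows "(\<integral>\<^sup>+x. ennreal (g x) * indicator {x. l * g x < 1} x \<partial>M) \<le> ennreal \<delta>"
proof -
  have h_int: "integrable M (h t)" if "0 \<le> t" for t
    using that g_nonneg unfolding h_def by (intro integrable_const_bound[of _ 1]) auto
  define s where "s n = 1 / real (Suc n)" for n
  have s: "s n > 0" for n
    unfolding s_def by simp
  define u where "u n x = ennreal (g x) * indicator {x. (l + s n) * g x \<le> 1} x" for n x
  have u_le: "integral\<^sup>N M (u n) \<le> ennreal \<delta>" for n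
  proof -
    have diff: "s n * (g x * indicator {x. (l + s n) * g x \<le> 1} x) \<le> h l x - h (l + s n) x" for x
    proof (cases "(l + s n) * g x \<le> 1")
      case True
      moreover have "0 \<le> s n * g x"
        using s[of n] g_nonneg[of x] by simp
      ultimately show ?thesis
        unfolding h_def by (simp add: distrib_right)
    next
      case False
      moreover have "0 \<le> s n * g x"
        using s[of n] g_nonneg[of x] by simp
      ultimately show ?thesis
        unfolding h_def by (simp add: distrib_right)
    qed
    have "ennreal (s n) * integral\<^sup>N M (u n) = (\<integral>\<^sup>+x. ennreal (s n) * u n x \<partial>M)"
      unfolding u_def by (rule nn_integral_cmult[symmetric]) measurable
    also have "\<dots> \<le> (\<integral>\<^sup>+x. ennreal (h l x - h (l + s n) x) \<partial>M)"
    proof (rule nn_integral_mono)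
      fix x
      have "ennreal (s n) * u n x = ennreal (s n * (g x * indicator {x. (l + s n) * g x \<le> 1} x))"
        using s[of n] g_nonneg[of x] unfolding u_def
        by (simp add: ennreal_mult indicator_def)
      also have "\<dots> \<le> ennreal (h l x - h (l + s n) x)"
        using diff by (rule ennreal_leI)
      finally show "ennreal (s n) * u n x \<le> ennreal (h l x - h (l + s n) x)" .
    qed
    also have "\<dots> = ennreal (\<integral>x. h l x - h (l + s n) x \<partial>M)"
    proof (rule nn_integral_eq_integral)
      show "integrable M (\<lambda>x. h l x - h (l + s n) x)"
        using s[of n] \<open>0 \<le> l\<close> by (intro Bochner_Integration.integrable_diff h_int) auto
      have "0 \<le> s n * (g x * indicator {x. (l + s n) * g x \<le> 1} x)" for x
        using s[of n] g_nonneg[of x] by (simp add: indicator_def)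
      then show "AE x in M. 0 \<le> h l x - h (l + s n) x"
        by (intro AE_I2 order_trans[OF _ diff])
    qed
    also have "\<dots> \<le> ennreal (s n * \<delta>)"
      using min[of "l + s n"] s[of n] \<open>0 \<le> l\<close> h_int
      by (intro ennreal_leI) (simp add: distrib_right)
    also have "\<dots> = ennreal (s n) * ennreal \<delta>"
      using s[of n] \<open>0 \<le> \<delta>\<close> by (simp add: ennreal_mult)
    finally show ?thesis
      using s[of n] by (subst (asm) ennreal_mult_le_mult_iff) auto
  qed
  have "(\<lambda>n. integral\<^sup>N M (u n)) \<longlonglongrightarrow> (\<integral>\<^sup>+x. ennreal (g x) * indicator {x. l * g x < 1} x \<partial>M)"
  proof (rule nn_integral_LIMSEQ)
    show "u n \<in> borel_measurable M" for n
      unfolding u_def by measurable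
    show "incseq u"
    proof (intro incseq_SucI le_funI)
      fix n x
      have "(l + s (Suc n)) * g x \<le> (l + s n) * g x"
        using g_nonneg[of x] unfolding s_def by (intro mult_right_mono) (auto simp: field_simps)
      then show "u n x \<le> u (Suc n) x"
        unfolding u_def by (auto simp: indicator_def)
    qed
    fix x
    have lim: "(\<lambda>n. (l + s n) * g x) \<longlonglongrightarrow> (l + 0) * g x"
      unfolding s_def by (intro tendsto_intros LIMSEQ_Suc[OF lim_1_over_n])
    show "(\<lambda>n. u n x) \<longlonglongrightarrow> ennreal (g x) * indicator {x. l * g x < 1} x"
    proof (cases "l * g x < 1")
      case True
      then have "\<forall>\<^sub>F n in sequentially. (l + s n) * g x < 1"
        using order_tendstoD(2)[OF lim] by simp
      then have "\<forall>\<^sub>F n in sequentially. u n x = ennreal (g x) * indicator {x. l * g x < 1} x"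
        by eventually_elim (use True in \<open>simp add: u_def\<close>)
      then show ?thesis
        by (rule tendsto_eventually)
    next
      case False
      then have "g x > 0"
        using g_nonneg[of x] by (cases "g x = 0") auto
      have "\<not> (l + s n) * g x \<le> 1" for n
        using False mult_pos_pos[OF s[of n] \<open>g x > 0\<close>] by (simp add: distrib_right)
      then show ?thesis
        using False by (simp add: u_def)
    qed
  qed
  then show ?thesis
    by (rule LIMSEQ_le_const2) (use u_le in blast)
qed

text \<open>
  The left derivative of the dual objective at a positive minimiser is nonpositive. Lowering the
  multiplier by \<open>s\<close> raises the integrand by at most \<open>s * g x\<close>, and only where \<open>(l - s) * g x < 1\<close>.
  As \<open>s\<close> decreases to 0 these sets shrink to \<open>{x. l * g x \<le> 1}\<close>, where the boundary value
  is included.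
\<close>
lemma (in prob_space) budget_le_cheap_cost_if_minimizer:
  fixes g :: "'a \<Rightarrow> real" and l \<delta> :: real
  defines "h \<equiv> \<lambda>t x. max (1 - t * g x) 0"
  assumes g [measurable]: "g \<in> borel_measurable M" and g_nonneg: "\<And>x. 0 \<le> g x"
    and "0 < l"
    and min: "\<And>t. 0 \<le> t \<Longrightarrow> l * \<delta> + expectation (h l) \<le> t * \<delta> + expectation (h t)"
  shows "\<delta> \<le> expectation (\<lambda>x. g x * indicator {x. l * g x \<le> 1} x)"
proof -
  have h_int: "integrable M (h t)" if "0 \<le> t" for t
    using that g_nonneg unfolding h_def by (intro integrable_const_bound[of _ 1]) auto
  \<comment> \<open>Dividing by at least 2 keeps \<open>l - s n \<ge> l / 2\<close>, which bounds \<open>u\<close> uniformly by \<open>2 / l\<close>.\<close>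
  define s where "s n = l / real (Suc (Suc n))" for n
  have s: "s n > 0" "s n \<le> l / 2" for n
    using \<open>0 < l\<close> unfolding s_def by (auto simp: field_simps)
  define u where "u n x = g x * indicator {x. (l - s n) * g x < 1} x" for n x
  have u_bound: "norm (u n x) \<le> 2 / l" for n x
  proof (cases "(l - s n) * g x < 1")
    case True
    have "l / 2 * g x \<le> (l - s n) * g x"
      using s(2)[of n] g_nonneg[of x] by (intro mult_right_mono) auto
    then show ?thesis
      using True g_nonneg[of x] \<open>0 < l\<close> by (simp add: u_def field_simps)
  qed (use \<open>0 < l\<close> in \<open>simp add: u_def\<close>)
  have u_meas [measurable]: "u n \<in> borel_measurable M" for n
    unfolding u_def by measurable
  have u_int: "integrable M (u n)" for n
    using u_bound by (intro integrable_const_bound[of _ "2 / l"]) auto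
  have le_u: "\<delta> \<le> expectation (u n)" for n
  proof -
    have "s n * \<delta> \<le> expectation (h (l - s n)) - expectation (h l)"
      using min[of "l - s n"] s[of n] \<open>0 < l\<close> by (simp add: left_diff_distrib)
    also have "\<dots> = (\<integral>x. h (l - s n) x - h l x \<partial>M)"
      using s[of n] \<open>0 < l\<close> by (intro Bochner_Integration.integral_diff[symmetric] h_int) auto
    also have "\<dots> \<le> (\<integral>x. s n * u n x \<partial>M)"
    proof (rule integral_mono)
      show "integrable M (\<lambda>x. h (l - s n) x - h l x)"
        using s[of n] \<open>0 < l\<close> by (intro Bochner_Integration.integrable_diff h_int) auto
      show "integrable M (\<lambda>x. s n * u n x)"
        by (intro integrable_mult_right u_int)
      fix x
      have "0 \<le> s n * g x"
        using s[of n] g_nonneg[of x] by simp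
      then show "h (l - s n) x - h l x \<le> s n * u n x"
        unfolding h_def u_def by (auto simp: left_diff_distrib indicator_def max_def)
    qed
    also have "\<dots> = s n * expectation (u n)"
      by simp
    finally show ?thesis
      using s[of n] by simp
  qed
  have "(\<lambda>n. expectation (u n)) \<longlonglongrightarrow> expectation (\<lambda>x. g x * indicator {x. l * g x \<le> 1} x)"
  proof (rule integral_dominated_convergence[where w="\<lambda>_. 2 / l"])
    show "AE x in M. (\<lambda>n. u n x) \<longlonglongrightarrow> g x * indicator {x. l * g x \<le> 1} x"
    proof (rule AE_I2)
      fix x
      have lim: "(\<lambda>n. (l - s n) * g x) \<longlonglongrightarrow> (l - 0) * g x"
        unfolding s_def divide_inverse[of l]
        by (intro tendsto_intros tendsto_mult_right_zero LIMSEQ_Suc[OF LIMSEQ_inverse_real_of_nat])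
      show "(\<lambda>n. u n x) \<longlonglongrightarrow> g x * indicator {x. l * g x \<le> 1} x"
      proof (cases "l * g x \<le> 1")
        case True
        have "u n x = g x" for n
        proof (cases "g x = 0")
          case False
          then have "s n * g x > 0"
            using s[of n] g_nonneg[of x] by simp
          then have "(l - s n) * g x < 1"
            using True by (simp add: left_diff_distrib)
          then show ?thesis by (simp add: u_def)
        qed (simp add: u_def)
        then show ?thesis
          using True by simp
      next
        case False
        then have "\<forall>\<^sub>F n in sequentially. 1 < (l - s n) * g x"
          using order_tendstoD(1)[OF lim] by simp
        then have "\<forall>\<^sub>F n in sequentially. u n x = g x * indicator {x. l * g x \<le> 1} x"
          by eventually_elim (use False in \<open>simp add: u_def\<close>)
        then show ?thesis
          by (rule tendsto_eventually)
      qed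
    qed
  qed (auto intro!: AE_I2 u_bound[unfolded real_norm_def])
  then show ?thesis
    by (rule LIMSEQ_le_const) (use le_u in blast)
qed

text \<open>
  For \<open>l > 0\<close> the two derivative conditions and the equality of the costs give that the cheap points
  \<open>E\<close> cost exactly \<open>\<delta>\<close>. Then \<open>l * \<delta>\<close> cancels against the cost term in
  \<open>\<integral> max (1 - l * g) 0 = P(E) - l * \<integral>\<^sub>E g\<close>.
\<close>
lemma (in prob_space) dual_minimum_eq_measure_of_cheap_points:
  fixes g :: "'a \<Rightarrow> real" and l \<delta> :: real
  defines "h \<equiv> \<lambda>t x. max (1 - t * g x) 0"
  assumes g [measurable]: "g \<in> borel_measurable M" and g_nonneg: "\<And>x. 0 \<le> g x"
    and "0 \<le> l"  and "0 \<le> \<delta>"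
    and min: "\<And>t. 0 \<le> t \<Longrightarrow> l * \<delta> + expectation (h l) \<le> t * \<delta> + expectation (h t)"
    and eq: "(\<integral>\<^sup>+x. ennreal (g x) * indicator {x. l * g x < 1} x \<partial>M) =
      (\<integral>\<^sup>+x. ennreal (g x) * indicator {x. l * g x \<le> 1} x \<partial>M)"
  shows "l * \<delta> + expectation (h l) = prob {x \<in> space M. l * g x \<le> 1}"
proof (cases "l = 0")
  case True
  then show ?thesis
    unfolding h_def by (simp add: prob_space)
next
  case False
  then have "0 < l" using \<open>0 \<le> l\<close> by simp
  define E where "E = {x \<in> space M. l * g x \<le> 1}"
  define v where "v x = g x * indicator {x. l * g x \<le> 1} x" for x
  have E [measurable]: "E \<in> sets M"
    unfolding E_def by measurable
  have v_bound: "norm (v x) \<le> 1 / l" for x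
    using g_nonneg[of x] \<open>0 < l\<close> by (auto simp: v_def field_simps indicator_def)
  have v_meas [measurable]: "v \<in> borel_measurable M"
    unfolding v_def by measurable
  have v_int: "integrable M v"
    using v_bound by (intro integrable_const_bound[of _ "1 / l"]) auto
  have v_nonneg: "0 \<le> v x" for x
    using g_nonneg[of x] unfolding v_def by simp
  have "ennreal (expectation v) = (\<integral>\<^sup>+x. ennreal (v x) \<partial>M)"
    using v_nonneg by (intro nn_integral_eq_integral[symmetric] v_int) auto
  also have "\<dots> = (\<integral>\<^sup>+x. ennreal (g x) * indicator {x. l * g x \<le> 1} x \<partial>M)"
    unfolding v_def by (intro nn_integral_cong) (simp add: indicator_def)
  also have "\<dots> \<le> ennreal \<delta>"
    unfolding eq[symmetric]
    by (rule strictly_cheap_cost_le_budget_if_minimizer[OF g g_nonneg \<open>0 \<le> l\<close> \<open>0 \<le> \<delta>\<close> min[unfolded h_def]])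
  finally have "expectation v \<le> \<delta>"
    using \<open>0 \<le> \<delta>\<close> by simp
  moreover have "\<delta> \<le> expectation v"
    unfolding v_def
    by (rule budget_le_cheap_cost_if_minimizer[OF g g_nonneg \<open>0 < l\<close> min[unfolded h_def]])
  ultimately have "expectation v = \<delta>" by simp
  have "expectation (h l) = (\<integral>x. indicator E x - l * v x \<partial>M)"
    unfolding h_def E_def v_def by (intro Bochner_Integration.integral_cong) (auto simp: indicator_def)
  also have "\<dots> = prob E - l * expectation v"
  proof -
    have "integrable M (indicat_real E)"
      by (intro integrable_const_bound[of _ 1]) (auto simp: indicator_def)
    then show ?thesis
      using v_int by (subst Bochner_Integration.integral_diff) auto
  qed
  finally show ?thesis
    unfolding \<open>expectation v = \<delta>\<close> E_def by simp
qed

section \<open>Transport plans that fill the target\<close>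

text \<open>
  Flip a coin with success probability \<open>t\<close> to decide which measure to sample from. Describing the
  mixture by its integrals serves the marginals, the cost and the mass of the target alike.
\<close>
lemma mixture_of_probability_measures:
  fixes p q :: "'a::topological_space measure" and t :: real
  assumes p: "p \<in> space (prob_algebra borel)" and q: "q \<in> space (prob_algebra borel)"
    and t: "0 \<le> t" "t \<le> 1"
  shows "\<exists>r\<in>space (prob_algebra borel). \<forall>f\<in>borel_measurable borel.
      (\<integral>\<^sup>+x. f x \<partial>r) = ennreal t * (\<integral>\<^sup>+x. f x \<partial>p) + ennreal (1 - t) * (\<integral>\<^sup>+x. f x \<partial>q)"
proof -
  define K where "K b = (if b then p else q)" for b
  define r where "r = measure_pmf (bernoulli_pmf t) \<bind> K"
  have K: "K \<in> measure_pmf (bernoulli_pmf t) \<rightarrow>\<^sub>M prob_algebra borel"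
    using p q unfolding K_def by simp
  then have K': "K \<in> measure_pmf (bernoulli_pmf t) \<rightarrow>\<^sub>M subprob_algebra borel"
    by (rule measurable_prob_algebraD)
  have "sets r = sets borel"
    unfolding r_def using sets_kernel[OF K'] by (intro sets_bind) auto
  moreover have "prob_space r"
    unfolding r_def using p q
    by (intro prob_space.prob_space_bind[OF _ _ K'] measure_pmf.prob_space_axioms AE_I2)
       (auto simp: K_def space_prob_algebra)
  ultimately have "r \<in> space (prob_algebra borel)"
    by (simp add: space_prob_algebra)
  moreover have "(\<integral>\<^sup>+x. f x \<partial>r) = ennreal t * (\<integral>\<^sup>+x. f x \<partial>p) + ennreal (1 - t) * (\<integral>\<^sup>+x. f x \<partial>q)"
    if "f \<in> borel_measurable borel" for f
    unfolding r_def nn_integral_bind[OF that K'] using t by (simp add: K_def mult.commute)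
  ultimately show ?thesis
    by (intro bexI[of _ r] ballI)
qed

text \<open>
  The plan that moves \<open>x\<close> to \<open>T x\<close>. Although \<open>T\<close> is only completion-measurable, its graph carries a
  Borel measure whose first marginal is \<open>M\<close> itself.
\<close>
lemma graph_coupling:
  fixes M :: "'a::polish_space measure"
    and T :: "'a \<Rightarrow> 'b::second_countable_topology"
  assumes M: "M \<in> space (prob_algebra borel)" and T: "T \<in> completion M \<rightarrow>\<^sub>M borel"
  shows "\<exists>\<pi>\<in>space (prob_algebra borel). distr \<pi> borel fst = M \<and>
    (\<forall>f\<in>borel_measurable borel. (\<integral>\<^sup>+z. f z \<partial>\<pi>) = (\<integral>\<^sup>+x. f (x, T x) \<partial>completion M))"
proof -
  have M': "sets M = sets borel" and "prob_space M"
    using M by (auto simp: space_prob_algebra)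
  interpret M: prob_space M by (rule \<open>prob_space M\<close>)
  have id: "(\<lambda>x. x) \<in> M \<rightarrow>\<^sub>M borel"
    using M' by (rule measurable_ident_sets)
  have G: "(\<lambda>x. (x, T x)) \<in> completion M \<rightarrow>\<^sub>M borel"
    by (rule borel_measurable_Pair[OF measurable_completion[OF id] T])
  define \<pi> where "\<pi> = distr (completion M) borel (\<lambda>x. (x, T x))"
  have "\<pi> \<in> space (prob_algebra borel)"
    unfolding \<pi>_def using G
    by (auto simp: space_prob_algebra intro!: prob_space.prob_space_distr M.prob_space_completion)
  moreover have "distr \<pi> borel fst = M"
  proof -
    have "distr \<pi> borel fst = distr (completion M) borel (\<lambda>x. x)"
      unfolding \<pi>_def by (subst distr_distr[OF borel_measurable_fst_snd_borel(1) G]) (simp add: comp_def)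
    also have "\<dots> = distr M borel (\<lambda>x. x)"
      by (rule distr_completion[OF id])
    also have "\<dots> = M"
      by (rule distr_id2) (simp add: M')
    finally show ?thesis .
  qed
  moreover have "(\<integral>\<^sup>+z. f z \<partial>\<pi>) = (\<integral>\<^sup>+x. f (x, T x) \<partial>completion M)"
    if "f \<in> borel_measurable borel" for f
    unfolding \<pi>_def using that by (intro nn_integral_distr[OF G]) simp
  ultimately show ?thesis
    by (intro bexI[of _ \<pi>] conjI ballI)
qed

text \<open>
  The primal construction: \<open>p\<close> moves the points of \<open>E\<close> almost optimally into \<open>A\<close> and leaves the others
  in place, \<open>q\<close> leaves everything in place, and the weight \<open>\<delta> / (\<delta> + e)\<close> on \<open>p\<close> brings the total cost
  from \<open>\<delta> + e\<close> down to \<open>\<delta>\<close>.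
\<close>
lemma feasible_law_charging_target:
  fixes M :: "'a::polish_space measure"
  assumes M: "M \<in> space (prob_algebra borel)"
    and c: "\<And>z. 0 \<le> c z" "lower_semicontinuous c" "\<And>x. c (x, x) = 0"
    and A: "closed A" "A \<noteq> {}"
    and E: "E \<in> sets (completion M)"
    and budget: "(\<integral>\<^sup>+x. ennreal (cost_to_set c x A) * indicator E x \<partial>completion M) \<le> ennreal \<delta>"
    and "0 < \<delta>" "0 < e"
  obtains P where "P \<in> space (prob_algebra borel)" "transport_cost c M P \<le> ennreal \<delta>"
    "\<delta> / (\<delta> + e) * measure (completion M) E \<le> measure P A"
proof -
  have M': "sets M = sets borel" and "prob_space M"
    using M by (auto simp: space_prob_algebra)
  interpret M: prob_space M by (rule \<open>prob_space M\<close>)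
  interpret C: prob_space "completion M" by (rule M.prob_space_completion)
  have space: "space M = UNIV"
    using sets_eq_imp_space_eq[OF M'] by simp
  note fst_snd = borel_measurable_fst_snd_borel
  have c_meas: "(\<lambda>z. ennreal (c z)) \<in> borel_measurable borel"
    using borel_measurable_lower_semicontinuous[OF c(2)] by measurable
  have g_meas [measurable]: "(\<lambda>x. cost_to_set c x A) \<in> borel_measurable (completion M)"
    by (rule borel_measurable_cost_to_set[where c=c, OF M' M.finite_measure_axioms c(1,2) A])
  note E [measurable]
  obtain T where T: "T \<in> completion M \<rightarrow>\<^sub>M borel" "\<And>x. T x \<in> A"
    "\<And>x. c (x, T x) \<le> cost_to_set c x A + e"
    using nearly_optimal_measurable_move[where c=c, OF M' M.finite_measure_axioms c(1,2) A \<open>0 < e\<close>]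
    by metis
  have id: "(\<lambda>x. x) \<in> completion M \<rightarrow>\<^sub>M borel"
    by (intro measurable_completion measurable_ident_sets M')
  define S where "S x = (if x \<in> E then T x else x)" for x
  have S: "S \<in> completion M \<rightarrow>\<^sub>M borel"
    unfolding S_def using E by (intro measurable_If T(1) id) (simp add: space)
  define t where "t = \<delta> / (\<delta> + e)"
  have t: "0 \<le> t" "t \<le> 1" "t * (\<delta> + e) = \<delta>"
    using \<open>0 < \<delta>\<close> \<open>0 < e\<close> unfolding t_def by (auto simp: field_simps)
  obtain p where p: "p \<in> space (prob_algebra borel)" "distr p borel fst = M"
    and p_int: "\<And>f. f \<in> borel_measurable borel \<Longrightarrow>
      (\<integral>\<^sup>+z. f z \<partial>p) = (\<integral>\<^sup>+x. f (x, S x) \<partial>completion M)"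
    using graph_coupling[OF M S] by blast
  obtain q where q: "q \<in> space (prob_algebra borel)" "distr q borel fst = M"
    and q_int: "\<And>f. f \<in> borel_measurable borel \<Longrightarrow>
      (\<integral>\<^sup>+z. f z \<partial>q) = (\<integral>\<^sup>+x. f (x, x) \<partial>completion M)"
    using graph_coupling[OF M id] by blast
  obtain r where r: "r \<in> space (prob_algebra borel)"
    and r_int: "\<And>f. f \<in> borel_measurable borel \<Longrightarrow>
      (\<integral>\<^sup>+x. f x \<partial>r) = ennreal t * (\<integral>\<^sup>+x. f x \<partial>p) + ennreal (1 - t) * (\<integral>\<^sup>+x. f x \<partial>q)"
    using mixture_of_probability_measures[OF p(1) q(1) t(1,2)] by blast
  have sets: "sets p = sets borel" "sets q = sets borel" "sets r = sets borel"
    using p q r by (auto simp: space_prob_algebra)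
  have meas: "fst \<in> p \<rightarrow>\<^sub>M borel" "fst \<in> q \<rightarrow>\<^sub>M borel" "fst \<in> r \<rightarrow>\<^sub>M borel" "snd \<in> r \<rightarrow>\<^sub>M borel"
    using fst_snd unfolding measurable_cong_sets[OF sets(1) refl] measurable_cong_sets[OF sets(2) refl]
      measurable_cong_sets[OF sets(3) refl] by auto
  define P where "P = distr r borel snd"
  have P: "P \<in> space (prob_algebra borel)"
    using r meas(4) unfolding P_def by (auto simp: space_prob_algebra intro!: prob_space.prob_space_distr)
  have "distr r borel fst = M"
  proof (rule measure_eqI)
    fix X assume "X \<in> sets (distr r borel fst)"
    then have X: "X \<in> sets borel" by simp
    have ind: "(\<lambda>z. indicator X (fst z)) \<in> borel_measurable borel"
      using X by (intro measurable_compose[OF fst_snd(1)]) auto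
    have eq: "(\<integral>\<^sup>+z. indicator X (fst z) \<partial>\<pi>) = emeasure (distr \<pi> borel fst) X"
      if "fst \<in> \<pi> \<rightarrow>\<^sub>M borel" for \<pi> :: "('a \<times> 'a) measure"
    proof -
      have "(\<integral>\<^sup>+z. indicator X (fst z) \<partial>\<pi>) = (\<integral>\<^sup>+x. indicator X x \<partial>distr \<pi> borel fst)"
        using X by (intro nn_integral_distr[symmetric] that) auto
      also have "\<dots> = emeasure (distr \<pi> borel fst) X"
        using X by (intro nn_integral_indicator) auto
      finally show ?thesis .
    qed
    have "emeasure (distr r borel fst) X = ennreal t * emeasure M X + ennreal (1 - t) * emeasure M X"
      using r_int[OF ind] unfolding eq[OF meas(1)] eq[OF meas(2)] eq[OF meas(3)] p q .
    also have "\<dots> = (ennreal t + ennreal (1 - t)) * emeasure M X"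
      by (rule distrib_right[symmetric])
    also have "ennreal t + ennreal (1 - t) = 1"
      using t by (simp add: ennreal_plus[symmetric] del: ennreal_plus)
    finally show "emeasure (distr r borel fst) X = emeasure M X" by simp
  qed (simp add: M')
  then have "r \<in> couplings M P"
    using r unfolding couplings_def P_def by simp
  then have "transport_cost c M P \<le> (\<integral>\<^sup>+z. ennreal (c z) \<partial>r)"
    unfolding transport_cost_def by (rule INF_lower)
  also have "\<dots> = ennreal t * (\<integral>\<^sup>+x. ennreal (c (x, S x)) \<partial>completion M)"
    unfolding r_int[OF c_meas] p_int[OF c_meas] q_int[OF c_meas] c(3) by simp
  also have "\<dots> \<le> ennreal t * ennreal (\<delta> + e)"
  proof (rule mult_left_mono)
    have "(\<integral>\<^sup>+x. ennreal (c (x, S x)) \<partial>completion M)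
        \<le> (\<integral>\<^sup>+x. ennreal (cost_to_set c x A) * indicator E x + ennreal e \<partial>completion M)"
    proof (rule nn_integral_mono)
      fix x
      show "ennreal (c (x, S x)) \<le> ennreal (cost_to_set c x A) * indicator E x + ennreal e"
        using T(3)[of x] c(3)[of x] cost_to_set_nonneg[of c, OF c(1) A(2), of x] \<open>0 < e\<close>
        unfolding S_def by (simp add: ennreal_plus[symmetric] del: ennreal_plus)
    qed
    also have "\<dots> = (\<integral>\<^sup>+x. ennreal (cost_to_set c x A) * indicator E x \<partial>completion M) + ennreal e"
      using C.emeasure_space_1 by (subst nn_integral_add) auto
    also have "\<dots> \<le> ennreal \<delta> + ennreal e"
      using budget by (rule add_right_mono)
    also have "\<dots> = ennreal (\<delta> + e)"
      using \<open>0 < \<delta>\<close> \<open>0 < e\<close> by simp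
    finally show "(\<integral>\<^sup>+x. ennreal (c (x, S x)) \<partial>completion M) \<le> ennreal (\<delta> + e)" .
  qed simp
  also have "\<dots> = ennreal \<delta>"
    using t \<open>0 < \<delta>\<close> \<open>0 < e\<close> by (subst ennreal_mult[symmetric]) auto
  finally have "transport_cost c M P \<le> ennreal \<delta>" .
  moreover have "t * measure (completion M) E \<le> measure P A"
  proof -
    interpret P: prob_space P
      using P by (simp add: space_prob_algebra)
    have ind: "(\<lambda>z. indicator A (snd z)) \<in> borel_measurable borel"
      using A(1) by (intro measurable_compose[OF fst_snd(2)]) auto
    have "ennreal (t * measure (completion M) E) = ennreal t * (\<integral>\<^sup>+x. indicator E x \<partial>completion M)"
      using t E by (simp add: C.emeasure_eq_measure ennreal_mult)
    also have "\<dots> \<le> ennreal t * (\<integral>\<^sup>+x. indicator A (S x) \<partial>completion M)"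
      using T(2) by (intro mult_left_mono nn_integral_mono) (auto simp: S_def indicator_def)
    also have "\<dots> = ennreal t * (\<integral>\<^sup>+z. indicator A (snd z) \<partial>p)"
      using p_int[OF ind] by simp
    also have "\<dots> \<le> (\<integral>\<^sup>+z. indicator A (snd z) \<partial>r)"
      unfolding r_int[OF ind] by simp
    also have "\<dots> = (\<integral>\<^sup>+y. indicator A y \<partial>P)"
      unfolding P_def using A(1) by (intro nn_integral_distr[symmetric] meas) auto
    also have "\<dots> = ennreal (measure P A)"
      using A(1) by (subst nn_integral_indicator) (auto simp: P_def P.emeasure_eq_measure[unfolded P_def])
    finally show ?thesis
      by simp
  qed
  ultimately show thesis
    using P that unfolding t_def by blast
qed

section \<open>Strong duality\<close>

lemma ennreal_less_inverse_iff:
  assumes "0 \<le> g" "0 \<le> l"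
  shows "ennreal g < 1 / ennreal l \<longleftrightarrow> l * g < 1" and "ennreal g \<le> 1 / ennreal l \<longleftrightarrow> l * g \<le> 1"
proof -
  have "1 / ennreal l = (if l = 0 then \<infinity> else ennreal (1 / l))"
    using assms(2) divide_ennreal[of 1 l] by (auto simp: ennreal_divide_zero)
  then show "ennreal g < 1 / ennreal l \<longleftrightarrow> l * g < 1" "ennreal g \<le> 1 / ennreal l \<longleftrightarrow> l * g \<le> 1"
    using assms by (auto simp: ennreal_less_iff field_simps)
qed

theorem theorem3:
  fixes \<mu> :: "'a::polish_space measure"
    and c :: "'a \<times> 'a \<Rightarrow> real"
    and A :: "'a set"
    and \<delta> l :: real
  assumes "\<mu> \<in> space (prob_algebra borel)"
    and "\<delta> > 0"
    and "\<And>z. 0 \<le> c z"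
    and "lower_semicontinuous c"
    and "\<And>x y. c (x, y) = 0 \<longleftrightarrow> x = y"
    and "closed A"
    and "A \<noteq> {}"
    and "l \<ge> 0"
    and "dual_objective c \<mu> A \<delta> l = (INF l'\<in>{0..}. dual_objective c \<mu> A \<delta> l')"
    and "lower_cost c \<mu> A l = upper_cost c \<mu> A l"
  shows "(SUP P\<in>{P \<in> space (prob_algebra borel). transport_cost c \<mu> P \<le> ennreal \<delta>}. measure P A) =
         measure (completion \<mu>) {x. ennreal (cost_to_set c x A) \<le> 1 / ennreal l}"
proof -
  note mu = assms(1) and c = assms(3,4) and A = assms(6,7)
  have sets: "sets \<mu> = sets borel" and "prob_space \<mu>"
    using mu by (auto simp: space_prob_algebra)
  interpret M: prob_space \<mu> by (rule \<open>prob_space \<mu>\<close>)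
  interpret C: prob_space "completion \<mu>" by (rule M.prob_space_completion)
  have space: "space \<mu> = UNIV"
    using sets_eq_imp_space_eq[OF sets] by simp
  define g where "g x = cost_to_set c x A" for x
  have g_meas [measurable]: "g \<in> borel_measurable (completion \<mu>)"
    unfolding g_def by (rule borel_measurable_cost_to_set[where c=c, OF sets M.finite_measure_axioms c A])
  have g_nonneg: "0 \<le> g x" for x
    unfolding g_def by (rule cost_to_set_nonneg[of c, OF c(1) A(2)])
  define E where "E = {x. l * g x \<le> 1}"
  have E_eq: "{x. ennreal (cost_to_set c x A) \<le> 1 / ennreal l} = E"
    unfolding E_def g_def[symmetric] using ennreal_less_inverse_iff[OF g_nonneg \<open>l \<ge> 0\<close>] by simp
  have E: "E \<in> sets (completion \<mu>)"
  proof -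
    have "{x \<in> space (completion \<mu>). l * g x \<le> 1} \<in> sets (completion \<mu>)"
      by measurable
    then show ?thesis
      unfolding E_def by (simp add: space)
  qed
  have dual: "dual_objective c \<mu> A \<delta> t = t * \<delta> + C.expectation (\<lambda>x. max (1 - t * g x) 0)" for t
    unfolding dual_objective_def g_def ..
  have "bdd_below (dual_objective c \<mu> A \<delta> ` {0..})"
    using \<open>\<delta> > 0\<close> unfolding dual
    by (intro bdd_belowI2[of _ 0]) (auto intro!: add_nonneg_nonneg Bochner_Integration.integral_nonneg)
  then have min: "l * \<delta> + C.expectation (\<lambda>x. max (1 - l * g x) 0)
      \<le> t * \<delta> + C.expectation (\<lambda>x. max (1 - t * g x) 0)" if "0 \<le> t" for t
    using assms(9) cINF_lower[of "dual_objective c \<mu> A \<delta>" "{0..}" t] that unfolding dual by simp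
  have eq: "(\<integral>\<^sup>+x. ennreal (g x) * indicator {x. l * g x < 1} x \<partial>completion \<mu>) =
      (\<integral>\<^sup>+x. ennreal (g x) * indicator {x. l * g x \<le> 1} x \<partial>completion \<mu>)"
    using assms(10) ennreal_less_inverse_iff[OF g_nonneg \<open>l \<ge> 0\<close>]
    unfolding lower_cost_def upper_cost_def g_def[symmetric] by simp
  have optimum: "dual_objective c \<mu> A \<delta> l = measure (completion \<mu>) E"
    using C.dual_minimum_eq_measure_of_cheap_points[OF g_meas g_nonneg \<open>l \<ge> 0\<close> less_imp_le[OF \<open>\<delta> > 0\<close>] min eq]
    unfolding dual E_def by (simp add: space)
  have budget: "(\<integral>\<^sup>+x. ennreal (cost_to_set c x A) * indicator E x \<partial>completion \<mu>) \<le> ennreal \<delta>"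
    using C.strictly_cheap_cost_le_budget_if_minimizer[OF g_meas g_nonneg \<open>l \<ge> 0\<close> less_imp_le[OF \<open>\<delta> > 0\<close>] min]
    unfolding eq unfolding E_def g_def by simp
  define F where "F = {P \<in> space (prob_algebra borel). transport_cost c \<mu> P \<le> ennreal \<delta>}"
  have upper: "measure P A \<le> measure (completion \<mu>) E" if "P \<in> F" for P
    using weak_duality[OF mu c A, of P \<delta> l] that \<open>\<delta> > 0\<close> \<open>l \<ge> 0\<close> unfolding F_def optimum by simp
  have lower: "\<exists>P\<in>F. \<delta> / (\<delta> + e) * measure (completion \<mu>) E \<le> measure P A" if "0 < e" for e
  proof -
    have "c (x, x) = 0" for x
      using assms(5) by simp
    from feasible_law_charging_target[OF mu c this A E budget \<open>\<delta> > 0\<close> that]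
    obtain P where "P \<in> space (prob_algebra borel)" "transport_cost c \<mu> P \<le> ennreal \<delta>"
      "\<delta> / (\<delta> + e) * measure (completion \<mu>) E \<le> measure P A"
      by metis
    then show ?thesis
      unfolding F_def by blast
  qed
  have "F \<noteq> {}"
    using lower[of 1] by auto
  have "(SUP P\<in>F. measure P A) = measure (completion \<mu>) E"
  proof (rule antisym)
    show "(SUP P\<in>F. measure P A) \<le> measure (completion \<mu>) E"
      using \<open>F \<noteq> {}\<close> upper by (rule cSUP_least)
    have bdd: "bdd_above ((\<lambda>P. measure P A) ` F)"
      using upper by (rule bdd_aboveI2)
    have "(\<lambda>n. \<delta> / (\<delta> + 1 / real (Suc n)) * measure (completion \<mu>) E) \<longlonglongrightarrow>
        \<delta> / (\<delta> + 0) * measure (completion \<mu>) E"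
      using \<open>\<delta> > 0\<close> by (intro tendsto_intros LIMSEQ_Suc[OF lim_1_over_n]) auto
    then have "(\<lambda>n. \<delta> / (\<delta> + 1 / real (Suc n)) * measure (completion \<mu>) E) \<longlonglongrightarrow> measure (completion \<mu>) E"
      using \<open>\<delta> > 0\<close> by simp
    then show "measure (completion \<mu>) E \<le> (SUP P\<in>F. measure P A)"
    proof (rule LIMSEQ_le_const2, intro exI allI impI)
      fix n :: nat
      obtain P where "P \<in> F" "\<delta> / (\<delta> + 1 / real (Suc n)) * measure (completion \<mu>) E \<le> measure P A"
        using lower[of "1 / real (Suc n)"] by auto
      then show "\<delta> / (\<delta> + 1 / real (Suc n)) * measure (completion \<mu>) E \<le> (SUP P\<in>F. measure P A)"
        using cSUP_upper[OF _ bdd] by (meson order_trans)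
    qed
  qed
  then show ?thesis
    unfolding F_def E_eq .
qed

end
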